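(* Consider grouped query attention with $p$ groups of size $q$ (so that $pq=h$, where $h$ is the number of heads), where $W_Q,W_K$ are of size $d\times v$ and the score matrix is of size $d\times d$. Then its data movement cost $D_{GQA}$ (coming from cold misses and from reuses of the matrices $W_Q,W_K$) satisfies $$D_{GQA}\sim p\Bigl(d^2+\frac{2d^2}{h}\Bigr)^{1.5}+2p(q-1)\frac{d^2}{h}\sqrt{l^2+\frac{4d^2}{h}}\;\sim\; p\,d^3 .$$
   Context: Cost model. In the data movement model, an access to a previously accessed datum at reuse distance $r$ (the amount of distinct data accessed since its previous access) costs $\sqrt r$, and the cold-miss initialization of a data object of size $m$ costs $m^{1.5}$. Setting. $d$ is the model dimension, $l$ is the input length, $h$ is the number of attention heads and $v=k=d/h$ is the projection dimension per head; $l,h\ll d$ is assumed. In grouped query attention, groups of attention heads share key and value vectors: there are $p$ groups, each consisting of $q$ heads. The quantity $D_{GQA}$ omits the cost of the matrix multiplications and counts only: (i) cold misses: for each of the $p$ groups, memory is allocated for two new matrices of $d^2/h$ entries each and for the score matrix of $d^2$ entries; (ii) reuses: in each of the $p$ groups, each of the two shared projection matrices (of $dv=d^2/h$ entries) is reused $q-1$ times, each entry's reuse costing $\sqrt{l^2+4d^2/h}$. Notation. $\sim$ is the asymptotic notation that is identical to big-O notation except that it retains the coefficients of the primary terms.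
   Formalization: The second ∼ (to p d³) is stated only when the number of heads h tends to infinity; for bounded h it fails, e.g. h = p = q = 1 gives 3^{1.5} d³ instead of d³. *)

theory Defs
  imports Complex_Main "HOL-Library.Landau_Symbols"
begin

unbundle asymp_equiv_syntax

text \<open>Data movement model: cost of one access at reuse distance \<open>r\<close>, and of the initialization
  of a data object of size \<open>m\<close>.\<close>

definition reuse_cost :: "nat \<Rightarrow> real" where
  "reuse_cost r = sqrt (real r)"

definition cold_miss_cost :: "nat \<Rightarrow> real" where
  "cold_miss_cost m = real m powr 1.5"

text \<open>Parameters below: model dimension \<open>d\<close>, input length \<open>l\<close>, number of heads \<open>h\<close>,
  \<open>p\<close> groups of \<open>q\<close> heads.\<close>

text \<open>The division is exact whenever \<open>h\<close> divides \<open>d\<close>, as is required for the projection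
  matrices to exist; then \<open>d * head_dim d h\<close> is the quantity $d^2/h$.\<close>

definition head_dim :: "nat \<Rightarrow> nat \<Rightarrow> nat" where
  "head_dim d h = d div h"

datatype projection = W_Q | W_K

definition projection_entries :: "nat \<Rightarrow> nat \<Rightarrow> (nat \<times> nat) set" where
  "projection_entries d h = {..<d} \<times> {..<head_dim d h}"

definition score_entries :: "nat \<Rightarrow> (nat \<times> nat) set" where
  "score_entries d = {..<d} \<times> {..<d}"

text \<open>The two projection matrices and the score matrix of a group are allocated together, so they
  are charged as a single data object.\<close>

definition GQA_cold_misses :: "nat \<Rightarrow> nat \<Rightarrow> nat \<Rightarrow> real" where
  "GQA_cold_misses d h p =
     (\<Sum>g<p. cold_miss_cost
        ((\<Sum>W\<in>{W_Q, W_K}. card (projection_entries d h)) + card (score_entries d)))"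

text \<open>The first of the \<open>q\<close> heads of a group initializes the shared matrices; each of the remaining
  heads reuses every entry once, at reuse distance $l^2 + 4d^2/h$.\<close>

definition GQA_reuses :: "nat \<Rightarrow> nat \<Rightarrow> nat \<Rightarrow> nat \<Rightarrow> nat \<Rightarrow> real" where
  "GQA_reuses d l h p q =
     (\<Sum>g<p. \<Sum>W\<in>{W_Q, W_K}. \<Sum>i\<in>{1..<q}. \<Sum>e\<in>projection_entries d h.
        reuse_cost (l ^ 2 + 4 * (d * head_dim d h)))"

definition D_GQA :: "nat \<Rightarrow> nat \<Rightarrow> nat \<Rightarrow> nat \<Rightarrow> nat \<Rightarrow> real" where
  "D_GQA d l h p q = GQA_cold_misses d h p + GQA_reuses d l h p q"

end

theory Submission
  imports Defs
begin

text \<open>The first equivalence is an exact equality: \<open>h\<close> divides \<open>d\<close>, and \<open>p * q = h > 0\<close> forces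
  \<open>q \<ge> 1\<close>, so neither the division nor the subtraction \<open>q - 1\<close> is truncated. For the second one,
  dividing by \<open>p * d ^ 3\<close> gives
  \<open>(1 + 2 / h) powr 1.5 + 2 * ((q - 1) / h) * sqrt ((l / d)\<^sup>2 + 4 / h)\<close>, where \<open>(q - 1) / h\<close> is
  bounded by 1 and the square root vanishes in the limit.\<close>

text \<open>The case \<open>h = 0\<close> is covered as well: divisibility then forces
  \<open>d = 0\<close>, and both sides are 0.\<close>

lemma d_times_head_dim:
  assumes "h dvd d"
  shows "real (d * head_dim d h) = real d ^ 2 / real h"
  using assms by (simp add: head_dim_def real_of_nat_div power2_eq_square)

lemma GQA_cold_misses_eq:
  assumes "h dvd d"
  shows "GQA_cold_misses d h p = real p * (real d ^ 2 + 2 * real d ^ 2 / real h) powr 1.5"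
proof -
  have "(\<Sum>W\<in>{W_Q, W_K}. card (projection_entries d h)) + card (score_entries d)
      = 2 * (d * head_dim d h) + d * d"
    by (simp add: projection_entries_def score_entries_def)
  moreover have "real (2 * (d * head_dim d h) + d * d) = real d ^ 2 + 2 * real d ^ 2 / real h"
    using d_times_head_dim[OF assms] by (simp add: power2_eq_square)
  ultimately show ?thesis
    by (simp only: GQA_cold_misses_def cold_miss_cost_def sum_constant card_lessThan)
qed

lemma GQA_reuses_eq:
  assumes "h dvd d" and "q > 0"
  shows "GQA_reuses d l h p q = 2 * real p * (real q - 1) * (real d ^ 2 / real h)
           * sqrt (real l ^ 2 + 4 * real d ^ 2 / real h)"
proof -
  have "GQA_reuses d l h p q = 2 * real p * (real q - 1) * real (d * head_dim d h)
          * sqrt (real (l ^ 2 + 4 * (d * head_dim d h)))"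
    using assms(2) by (simp add: GQA_reuses_def reuse_cost_def projection_entries_def of_nat_diff)
  also have "real (l ^ 2 + 4 * (d * head_dim d h)) = real l ^ 2 + 4 * real d ^ 2 / real h"
    using d_times_head_dim[OF assms(1)] by simp
  finally show ?thesis
    unfolding d_times_head_dim[OF assms(1)] .
qed

text \<open>Both cost terms are homogeneous of degree 3 in \<open>d\<close> and \<open>l\<close>
  jointly, so \<open>d ^ 3\<close> factors out and \<open>l\<close> survives only through
  \<open>l / d\<close>. Over the reals \<open>q - 1\<close> is ordinary subtraction.\<close>

lemma GQA_cost_ratio:
  fixes d h l p q :: real
  assumes "d > 0" "h > 0" "p > 0"
  shows "(p * (d ^ 2 + 2 * d ^ 2 / h) powr 1.5
            + 2 * p * (q - 1) * (d ^ 2 / h) * sqrt (l ^ 2 + 4 * d ^ 2 / h)) / (p * d ^ 3)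
         = (1 + 2 / h) powr 1.5 + 2 * ((q - 1) / h) * sqrt ((l / d) ^ 2 + 4 / h)"
proof -
  \<comment> \<open>Exponents multiply under \<open>powr\<close>, so the square is first rewritten
    as \<open>d powr 2\<close>; the passage between \<open>^\<close> and \<open>powr\<close> uses
    \<open>d > 0\<close>.\<close>
  have "(d ^ 2) powr 1.5 = (d powr 2) powr 1.5"
    using assms(1) by simp
  also have "\<dots> = d powr 3"
    unfolding powr_powr by simp
  also have "\<dots> = d ^ 3"
    using assms(1) by simp
  finally have "(d ^ 2) powr 1.5 = d ^ 3" .
  moreover have "d ^ 2 + 2 * d ^ 2 / h = d ^ 2 * (1 + 2 / h)"
    by (simp add: algebra_simps)
  ultimately have cold: "(d ^ 2 + 2 * d ^ 2 / h) powr 1.5 = d ^ 3 * (1 + 2 / h) powr 1.5"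
    using assms by (simp add: powr_mult)
  have "l ^ 2 + 4 * d ^ 2 / h = d ^ 2 * ((l / d) ^ 2 + 4 / h)"
    using assms by (simp add: field_simps)
  then have reuse: "sqrt (l ^ 2 + 4 * d ^ 2 / h) = d * sqrt ((l / d) ^ 2 + 4 / h)"
    using assms(1) by (simp add: real_sqrt_mult)
  show ?thesis
    unfolding cold reuse using assms
    by (simp add: field_simps power2_eq_square power3_eq_cube)
qed

theorem lemma3p6:
  fixes d l h p q :: "'a \<Rightarrow> nat" and F :: "'a filter"
  assumes groups: "\<And>x. p x * q x = h x"
    and head_dim_integral: "\<And>x. h x dvd d x"
    and h_pos: "\<And>x. h x > 0"
    and h_small: "(\<lambda>x. real (h x)) \<in> o[F](\<lambda>x. real (d x))"
    and l_small: "(\<lambda>x. real (l x)) \<in> o[F](\<lambda>x. real (d x))"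
  shows "((\<lambda>x. D_GQA (d x) (l x) (h x) (p x) (q x)) \<sim>[F]
          (\<lambda>x. real (p x) * (real (d x) ^ 2 + 2 * real (d x) ^ 2 / real (h x)) powr 1.5
             + 2 * real (p x) * (real (q x) - 1) * (real (d x) ^ 2 / real (h x))
               * sqrt (real (l x) ^ 2 + 4 * real (d x) ^ 2 / real (h x)))) \<and>
         (filterlim h at_top F \<longrightarrow>
         (\<lambda>x. real (p x) * (real (d x) ^ 2 + 2 * real (d x) ^ 2 / real (h x)) powr 1.5
             + 2 * real (p x) * (real (q x) - 1) * (real (d x) ^ 2 / real (h x))
               * sqrt (real (l x) ^ 2 + 4 * real (d x) ^ 2 / real (h x))) \<sim>[F]
          (\<lambda>x. real (p x) * real (d x) ^ 3))"
  (is "(?D \<sim>[F] ?C) \<and> (_ \<longrightarrow> ?C \<sim>[F] ?P)")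
proof (intro conjI impI)
  have p_pos: "p x > 0" and q_pos: "q x > 0" for x
    using groups[of x] h_pos[of x] by (auto intro!: Nat.gr0I)
  have "?D = ?C"
    using GQA_cold_misses_eq[OF head_dim_integral] GQA_reuses_eq[OF head_dim_integral q_pos]
    by (simp add: D_GQA_def)
  then show "?D \<sim>[F] ?C"
    by simp
  \<comment> \<open>Growth of \<open>h\<close> removes \<open>2 / h\<close> from the cold-miss
    factor and \<open>4 / h\<close> from under the root; for a constant \<open>h\<close> the
    cold-miss factor would stay above 1.\<close>
  assume "filterlim h at_top F"
  then have "filterlim (\<lambda>x. real (h x)) at_top F"
    using filterlim_compose filterlim_real_sequentially by blast
  then have h_inverse: "((\<lambda>x. c / real (h x)) \<longlongrightarrow> 0) F" for c
    by (intro tendsto_divide_0[OF tendsto_const] filterlim_at_top_imp_at_infinity)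
  \<comment> \<open>The little-o bound with constant 1 gives \<open>h \<le> d\<close> eventually,
    and \<open>h\<close> is positive.\<close>
  have d_pos: "eventually (\<lambda>x. real (d x) > 0) F"
    using landau_o.smallD[OF h_small zero_less_one]
    by eventually_elim (use h_pos in \<open>auto simp: intro: less_le_trans\<close>)
  have ratio_l_d: "((\<lambda>x. real (l x) / real (d x)) \<longlongrightarrow> 0) F"
    using l_small by (rule smalloD_tendsto)
  have root: "((\<lambda>x. sqrt ((real (l x) / real (d x)) ^ 2 + 4 / real (h x))) \<longlongrightarrow> 0) F"
    using tendsto_real_sqrt[OF tendsto_add[OF tendsto_power[OF ratio_l_d, of 2] h_inverse[of 4]]]
    by simp
  then have reuse: "((\<lambda>x. 2 * ((real (q x) - 1) / real (h x))
      * sqrt ((real (l x) / real (d x)) ^ 2 + 4 / real (h x))) \<longlongrightarrow> 0) F"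
  \<comment> \<open>\<open>K = 2\<close> is the leading factor 2 times the bound 1 on
    \<open>(q - 1) / h\<close>, which follows from \<open>q\<close> dividing
    \<open>h\<close>.\<close>
  proof (rule tendsto_0_le[where K = 2], intro always_eventually allI)
    fix x
    have "q x \<le> h x"
      using groups[of x] p_pos[of x] by (metis dvd_imp_le dvd_triv_right h_pos)
    then have "\<bar>(real (q x) - 1) / real (h x)\<bar> \<le> 1"
      using q_pos[of x] h_pos[of x] by (simp add: field_simps)
    moreover have "norm (2 * a * b) \<le> norm b * 2" if "\<bar>a\<bar> \<le> 1" for a b :: real
      using mult_right_mono[OF that, of "\<bar>b\<bar>"] by (simp add: abs_mult)
    ultimately show "norm (2 * ((real (q x) - 1) / real (h x))
        * sqrt ((real (l x) / real (d x)) ^ 2 + 4 / real (h x)))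
      \<le> norm (sqrt ((real (l x) / real (d x)) ^ 2 + 4 / real (h x))) * 2"
      by blast
  qed
  \<comment> \<open>Continuity of \<open>powr\<close> applies because the base tends to 1, which is
    nonzero.\<close>
  have "((\<lambda>x. (1 + 2 / real (h x)) powr 1.5) \<longlongrightarrow> 1) F"
    using tendsto_powr[OF tendsto_add[OF tendsto_const[of 1] h_inverse[of 2]] tendsto_const[of "1.5"]]
    by simp
  from tendsto_add[OF this reuse]
  have "((\<lambda>x. ?C x / ?P x) \<longlongrightarrow> 1 + 0) F"
  \<comment> \<open>The formula for the quotient requires \<open>d > 0\<close>, so it is transferred
    along an eventual equality.\<close>
  proof (rule Lim_transform_eventually)
    show "eventually (\<lambda>x. (1 + 2 / real (h x)) powr 1.5 + 2 * ((real (q x) - 1) / real (h x))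
        * sqrt ((real (l x) / real (d x)) ^ 2 + 4 / real (h x)) = ?C x / ?P x) F"
      using d_pos by eventually_elim (rule GQA_cost_ratio[symmetric], use h_pos p_pos in simp_all)
  qed
  then show "?C \<sim>[F] ?P"
    by (intro asymp_equivI') simp
qed

end
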